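(* Let $p$ be a prime, $p>3$, and let $t\in D_p$. If $t\not\equiv 0\pmod p$, then modulo $p$: \begin{align*} \sum_{k=1}^{\lfloor p/3\rfloor}C_k^{(2)}\bigl(t^{2}(t+1)\bigr)^k&\equiv \frac{1+t}{2t}-\frac{1-3t}{2t}\left(\frac{(1+t)(1-3t)}{p}\right),\\ \sum_{k=1}^{p-1}C_k^{(2)}\bigl(t^2(t+1)\bigr)^k&\equiv \frac{(1+t)(1-3t)}{2t}\left(1-\left(\frac{(1+t)(1-3t)}{p}\right)\right). \end{align*} If $3t+2\not\equiv 0\pmod p$, then modulo $p$: \begin{align*} \sum_{k=1}^{\lfloor p/3\rfloor}\binom{3k}{k}\bigl(t^2(t+1)\bigr)^k&\equiv \frac{3(t+1)}{2(3t+2)}\left(\left(\frac{(1+t)(1-3t)}{p}\right)-1\right),\\ \sum_{k=1}^{p-1}\binom{3k}{k}\bigl(t^2(t+1)\bigr)^k&\equiv \frac{3(t+1)^2}{2(3t+2)}\left(\left(\frac{(1+t)(1-3t)}{p}\right)-1\right). \end{align*}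
   Context: $C_n^{(2)}=\frac{1}{2n+1}\binom{3n}{n}$. $D_p$ is the set of rationals whose denominator is not divisible by $p$; congruences are in the usual sense. For $c=a/b\in D_p$ in lowest terms, $\left(\frac{c}{p}\right)=\left(\frac{ab}{p}\right)$ (Legendre symbol), which is $0$ if $p\mid a$. *)

theory Defs
  imports Complex_Main "HOL-Number_Theory.Number_Theory"
begin

definition D :: "nat \<Rightarrow> rat set"
  where "D p = {r. \<not> int p dvd snd (quotient_of r)}"

definition rat_cong :: "nat \<Rightarrow> rat \<Rightarrow> rat \<Rightarrow> bool"
  where "rat_cong p x y \<longleftrightarrow> (\<exists>z \<in> D p. x - y = of_nat p * z)"

(* quotient_of returns the numerator and denominator in lowest terms. *)
definition rat_Legendre :: "rat \<Rightarrow> nat \<Rightarrow> int"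
  where "rat_Legendre c p = Legendre (fst (quotient_of c) * snd (quotient_of c)) (int p)"

definition catalan2 :: "nat \<Rightarrow> rat"
  where "catalan2 n = 1 / of_nat (2 * n + 1) * of_nat ((3 * n) choose n)"

end

theory Submission
  imports Defs
begin

text \<open>
  Put \<open>z = t\<^sup>2 (t + 1)\<close> and \<open>u\<^sub>n = \<Sum>\<^sub>k binom (n - 2k) k (- z)\<^sup>k\<close>, so that
  \<open>u\<^sub>n\<^sub>+\<^sub>3 = u\<^sub>n\<^sub>+\<^sub>2 - z u\<^sub>n\<close>. For \<open>k < p\<close> a binomial coefficient \<open>binom x k\<close> modulo \<open>p\<close> depends only
  on \<open>x\<close> modulo \<open>p\<close>, hence \<open>binom (3k) k = (-1)\<^sup>k binom (-2k-1) k \<equiv> (-1)\<^sup>k binom (cp-1-2k) k\<close>.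
  Taking \<open>c = 1\<close> and \<open>c = 2\<close>, the truncated and the full sum of the \<open>binom (3k) k z\<^sup>k\<close> become
  \<open>u\<^sub>m\<^sub>-\<^sub>1\<close> with \<open>m = cp\<close>. Since the Catalan-type number is \<open>binom (3k) k - 2 binom (3k) (k-1)\<close>, its
  sums become \<open>3 u\<^sub>m\<^sub>-\<^sub>1 - 2 u\<^sub>m\<^sub>-\<^sub>2\<close> in the same way. The characteristic polynomial of \<open>u\<close> is
  \<open>X\<^sup>3 - X\<^sup>2 + z = (X + t) (X\<^sup>2 - (t + 1) X + t (t + 1))\<close>, whose quadratic factor has discriminant
  \<open>(1 + t) (1 - 3t)\<close>. So \<open>u\<^sub>m\<^sub>-\<^sub>1\<close> is a combination of \<open>(- t)\<^sup>m\<close> and of the two components of the \<open>m\<close>-th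
  power of a root of that factor; these are evaluated modulo \<open>p\<close> by Frobenius and Euler's criterion.
\<close>

section \<open>Binomial transforms and powers in a quadratic extension\<close>

definition binomial_transform :: "'a::comm_ring_1 \<Rightarrow> (nat \<Rightarrow> 'a) \<Rightarrow> nat \<Rightarrow> 'a"
  where "binomial_transform P w n = (\<Sum>i\<le>n. of_nat (n choose i) * P ^ (n - i) * w i)"

lemma binomial_transform_0 [simp]: "binomial_transform P w 0 = w 0"
  by (simp add: binomial_transform_def)

text \<open>This is Pascal's rule. It exhibits the transform as the value at index 0 of
  \<open>(P + S) ^ n\<close> applied to \<open>w\<close>, where \<open>S\<close> is the shift
  operator.\<close>

lemma binomial_transform_Suc:
  "binomial_transform P w (Suc n)
     = P * binomial_transform P w n + binomial_transform P (\<lambda>i. w (Suc i)) n"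
proof -
  have "P * binomial_transform P w n = (\<Sum>i\<le>n. of_nat (n choose i) * P ^ (Suc n - i) * w i)"
    unfolding binomial_transform_def sum_distrib_left
    by (rule sum.cong) (auto simp: Suc_diff_le algebra_simps)
  also have "\<dots> = (\<Sum>i\<le>Suc n. of_nat (n choose i) * P ^ (Suc n - i) * w i)"
    by (simp add: binomial_eq_0)
  also have "\<dots> = P ^ Suc n * w 0 + (\<Sum>i\<le>n. of_nat (n choose Suc i) * P ^ (n - i) * w (Suc i))"
    by (subst sum.atMost_Suc_shift) simp
  finally have *: "P * binomial_transform P w n
    = P ^ Suc n * w 0 + (\<Sum>i\<le>n. of_nat (n choose Suc i) * P ^ (n - i) * w (Suc i))" .
  have "binomial_transform P w (Suc n) = P ^ Suc n * w 0
     + (\<Sum>i\<le>n. of_nat (Suc n choose Suc i) * P ^ (n - i) * w (Suc i))"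
    unfolding binomial_transform_def by (subst sum.atMost_Suc_shift) simp
  also have "\<dots> = P * binomial_transform P w n + binomial_transform P (\<lambda>i. w (Suc i)) n"
    unfolding * by (simp add: binomial_transform_def sum.distrib algebra_simps)
  finally show ?thesis .
qed

lemma binomial_transform_scale:
  "binomial_transform P (\<lambda>i. c * w i) n = c * binomial_transform P w n"
  by (simp add: binomial_transform_def sum_distrib_left algebra_simps)

text \<open>The formal identity behind the next two sequences is
  \<open>(P + s) ^ n = quad_re P E n + quad_im P E n * s\<close> with \<open>s\<^sup>2 = E\<close>.\<close>

definition quad_re :: "'a::comm_ring_1 \<Rightarrow> 'a \<Rightarrow> nat \<Rightarrow> 'a"
  where "quad_re P E = binomial_transform P (\<lambda>i. if even i then E ^ (i div 2) else 0)"

definition quad_im :: "'a::comm_ring_1 \<Rightarrow> 'a \<Rightarrow> nat \<Rightarrow> 'a"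
  where "quad_im P E = binomial_transform P (\<lambda>i. if odd i then E ^ (i div 2) else 0)"

lemma quad_0 [simp]: "quad_re P E 0 = 1" "quad_im P E 0 = 0"
  by (simp_all add: quad_re_def quad_im_def)

lemma quad_re_Suc: "quad_re P E (Suc n) = P * quad_re P E n + E * quad_im P E n"
proof -
  \<comment> \<open>The shift swaps the parities, and stepping from odd \<open>i\<close> to
    \<open>Suc i\<close> raises the exponent of \<open>E\<close> by one: this is the relation s^2 =
    E.\<close>
  have "(\<lambda>i. if even (Suc i) then E ^ (Suc i div 2) else 0)
    = (\<lambda>i. E * (if odd i then E ^ (i div 2) else 0))"
    by (auto elim!: oddE)
  then show ?thesis
    unfolding quad_re_def quad_im_def by (simp only: binomial_transform_Suc binomial_transform_scale)
qed

lemma quad_im_Suc: "quad_im P E (Suc n) = P * quad_im P E n + quad_re P E n"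
proof -
  have "(\<lambda>i. if odd (Suc i) then E ^ (Suc i div 2) else 0)
    = (\<lambda>i. if even i then E ^ (i div 2) else 0)"
    by (auto elim!: evenE)
  then show ?thesis
    unfolding quad_re_def quad_im_def by (simp only: binomial_transform_Suc)
qed

lemma quad_add:
  "quad_re P E (m + n) = quad_re P E m * quad_re P E n + E * quad_im P E m * quad_im P E n"
  "quad_im P E (m + n) = quad_re P E m * quad_im P E n + quad_im P E m * quad_re P E n"
  by (induction m) (simp_all add: quad_re_Suc quad_im_Suc algebra_simps)

section \<open>The cubic recurrence and its closed form\<close>

definition cubic_seq :: "'a::comm_ring_1 \<Rightarrow> nat \<Rightarrow> 'a"
  where "cubic_seq z n = (\<Sum>k\<le>n. of_nat ((n - 2 * k) choose k) * (- z) ^ k)"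

text \<open>Terms with \<open>n < 3 * k\<close> vanish, also when \<open>n - 2 * k\<close> truncates
  to 0, because then \<open>k\<close> is positive. Hence every cutoff \<open>K\<close> with
  \<open>n < 3 * Suc K\<close> gives the same sum.\<close>

lemma cubic_seq_eq:
  assumes "n < 3 * Suc K"
  shows "cubic_seq z n = (\<Sum>k\<le>K. of_nat ((n - 2 * k) choose k) * (- z) ^ k)"
proof -
  have *: "of_nat ((n - 2 * k) choose k) * (- z) ^ k = 0" if "n < 3 * k" for k
    using that by (subst binomial_eq_0) auto
  have **: "{..n} \<subseteq> {..max n K}" "{..K} \<subseteq> {..max n K}"
    by auto
  have "cubic_seq z n = (\<Sum>k\<le>max n K. of_nat ((n - 2 * k) choose k) * (- z) ^ k)"
    unfolding cubic_seq_def by (rule sum.mono_neutral_left [OF _ **(1)]) (simp, intro ballI *, simp)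
  also have "\<dots> = (\<Sum>k\<le>K. of_nat ((n - 2 * k) choose k) * (- z) ^ k)"
    using assms by (intro sum.mono_neutral_right [OF _ **(2)]) (simp, intro ballI *, simp)
  finally show ?thesis .
qed

lemma cubic_seq_init: "cubic_seq z 0 = 1" "cubic_seq z (Suc 0) = 1" "cubic_seq z (Suc (Suc 0)) = 1"
  by (simp_all add: cubic_seq_eq[where K = 0])

lemma cubic_seq_rec:
  "cubic_seq z (Suc (Suc (Suc n))) = cubic_seq z (Suc (Suc n)) - z * cubic_seq z n"
proof -
  \<comment> \<open>Pascal's rule. If \<open>2 * k > n\<close>, all three upper arguments truncate
    to 0 while the lower ones are positive, so the identity reads 0 = 0 + 0.\<close>
  have *: "(Suc (Suc (Suc n)) - 2 * Suc k) choose Suc k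
      = ((Suc (Suc n) - 2 * Suc k) choose Suc k) + ((n - 2 * k) choose k)" for k
  proof (cases "2 * k \<le> n")
    case True
    then have "Suc (Suc (Suc n)) - 2 * Suc k = Suc (n - 2 * k)" "Suc (Suc n) - 2 * Suc k = n - 2 * k"
      by auto
    then show ?thesis by simp
  next
    case False
    then show ?thesis by (cases k) auto
  qed
  have "cubic_seq z (Suc (Suc (Suc n)))
      = (\<Sum>k\<le>Suc n. of_nat ((Suc (Suc (Suc n)) - 2 * k) choose k) * (- z) ^ k)"
    by (rule cubic_seq_eq) simp
  also have "\<dots> = 1 + (\<Sum>k\<le>n. of_nat ((Suc (Suc n) - 2 * Suc k) choose Suc k) * (- z) ^ Suc k)
      + (\<Sum>k\<le>n. of_nat ((n - 2 * k) choose k) * (- z) ^ Suc k)"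
    by (subst sum.atMost_Suc_shift) (simp only: *, simp add: sum.distrib distrib_right of_nat_add del: diff_Suc_Suc mult_Suc_right power_Suc)
  also have "(\<Sum>k\<le>n. of_nat ((n - 2 * k) choose k) * (- z) ^ Suc k) = - z * cubic_seq z n"
    by (simp add: cubic_seq_def sum_distrib_left algebra_simps)
  also have "1 + (\<Sum>k\<le>n. of_nat ((Suc (Suc n) - 2 * Suc k) choose Suc k) * (- z) ^ Suc k)
      = (\<Sum>k\<le>Suc n. of_nat ((Suc (Suc n) - 2 * k) choose k) * (- z) ^ k)"
    by (subst sum.atMost_Suc_shift) simp
  also have "\<dots> = cubic_seq z (Suc (Suc n))"
    by (rule cubic_seq_eq [symmetric]) simp
  finally show ?thesis by simp
qed

context
  fixes t P E z :: rat
  defines "P \<equiv> (t + 1) / 2" and "E \<equiv> (1 + t) * (1 - 3 * t) / 4" and "z \<equiv> t\<^sup>2 * (t + 1)"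
begin

text \<open>The roots of \<open>X\<^sup>2 - (t + 1) * X + t * (t + 1)\<close> are \<open>P \<plusminus> sqrt E\<close>.\<close>

lemma cubic_seq_Suc_plus:
  "cubic_seq z (Suc n) + t * cubic_seq z n = quad_im P E (Suc (Suc n))"
proof (induction n rule: induct_nat_012)
  case 0
  show ?case by (simp add: cubic_seq_init quad_im_Suc quad_re_Suc P_def)
next
  case 1
  show ?case
    by (simp add: cubic_seq_init quad_im_Suc quad_re_Suc P_def E_def field_simps power2_eq_square)
next
  case (ge2 n)
  \<comment> \<open>Adding \<open>t\<close> times the previous term divides the characteristic cubic
    by X + t, leaving the recurrence of the quadratic factor. The right-hand side obeys it too,
    since 2P = t + 1 and P^2 - E = t(t + 1).\<close>
  have "cubic_seq z (Suc (Suc (Suc n))) + t * cubic_seq z (Suc (Suc n))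
    = (t + 1) * (cubic_seq z (Suc (Suc n)) + t * cubic_seq z (Suc n))
      - t * (t + 1) * (cubic_seq z (Suc n) + t * cubic_seq z n)"
    by (simp add: cubic_seq_rec z_def algebra_simps power2_eq_square)
  also have "\<dots> = (t + 1) * quad_im P E (Suc (Suc (Suc n))) - t * (t + 1) * quad_im P E (Suc (Suc n))"
    by (simp only: ge2)
  also have "\<dots> = quad_im P E (Suc (Suc (Suc (Suc n))))"
    unfolding quad_im_Suc [of P E "Suc (Suc (Suc n))"] quad_im_Suc [of P E "Suc (Suc n)"]
      quad_re_Suc [of P E "Suc (Suc n)"]
    by (simp add: P_def E_def field_simps)
  finally show ?case .
qed

text \<open>Partial fractions: the quadratic factor takes the value t(3t + 2) at X = -t, whence the
  factor \<open>3 * t + 2\<close>. Without division the identity also covers 3t + 2 = 0.\<close>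

lemma cubic_seq_closed_form:
  "2 * (3 * t + 2) * cubic_seq z n
     = 2 * t * (- t) ^ n + 3 * (t + 1) * quad_im P E (Suc n) + 2 * quad_re P E (Suc n)"
proof (induction n)
  case 0
  show ?case by (simp add: cubic_seq_init quad_im_Suc quad_re_Suc P_def field_simps)
next
  case (Suc n)
  have u: "cubic_seq z (Suc n) = quad_im P E (Suc (Suc n)) - t * cubic_seq z n"
    using cubic_seq_Suc_plus [of n] by simp
  have "2 * (3 * t + 2) * cubic_seq z (Suc n)
      = 2 * (3 * t + 2) * quad_im P E (Suc (Suc n)) - t * (2 * (3 * t + 2) * cubic_seq z n)"
    unfolding u by (simp add: algebra_simps)
  also have "\<dots> = 2 * t * (- t) ^ Suc n + 3 * (t + 1) * quad_im P E (Suc (Suc n))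
      + 2 * quad_re P E (Suc (Suc n))"
    unfolding Suc quad_im_Suc [of P E "Suc n"] quad_re_Suc [of P E "Suc n"]
    by (simp add: P_def E_def field_simps)
  finally show ?case .
qed

text \<open>Writing 6t = 2(3t + 2) - 4 and absorbing the remainder by
  \<open>cubic_seq_Suc_plus\<close> trades the denominator 3t + 2 of the closed form for t.\<close>

lemma cubic_seq_catalan_form:
  "2 * t * (3 * cubic_seq z (Suc n) - 2 * cubic_seq z n)
     = 2 * t * (- t) ^ Suc n + (3 * t - 1) * quad_im P E (Suc (Suc n)) + 2 * quad_re P E (Suc (Suc n))"
proof -
  have "2 * t * (3 * cubic_seq z (Suc n) - 2 * cubic_seq z n)
    = 2 * (3 * t + 2) * cubic_seq z (Suc n) - 4 * quad_im P E (Suc (Suc n))"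
    unfolding cubic_seq_Suc_plus [symmetric] by (simp add: algebra_simps)
  then show ?thesis
    unfolding cubic_seq_closed_form by (simp add: algebra_simps)
qed

end

text \<open>The two binomials are in the ratio 2k + 1 to k, and 1 - 2k/(2k + 1) = 1/(2k + 1). This
  removes the denominator 2k + 1, which equals p at k = (p - 1)/2 in the full sum.\<close>

lemma catalan2_eq:
  assumes "0 < k"
  shows "catalan2 k = of_nat ((3 * k) choose k) - 2 * of_nat ((3 * k) choose (k - 1))"
proof -
  obtain j where j: "k = Suc j" using assms by (cases k) auto
  have "Suc j * ((3 * k) choose Suc j) = (3 * k - j) * ((3 * k) choose j)"
    by (metis binomial_absorb_comp binomial_absorption)
  also have "3 * k - j = 2 * k + 1" using j by simp
  finally have "k * ((3 * k) choose k) = (2 * k + 1) * ((3 * k) choose (k - 1))"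
    by (simp add: j)
  then have "of_nat k * of_nat ((3 * k) choose k)
      = (of_nat (2 * k + 1) * of_nat ((3 * k) choose (k - 1)) :: rat)"
    by (simp only: flip: of_nat_mult)
  moreover have "of_nat (2 * k + 1) \<noteq> (0 :: rat)" by (simp only: of_nat_eq_0_iff)
  ultimately show ?thesis
    unfolding catalan2_def by (simp add: field_simps)
qed

section \<open>Arithmetic and congruences in the ring of p-integral rationals\<close>

lemma of_int_divide_in_D:
  assumes "\<not> int p dvd b"
  shows "of_int a / of_int b \<in> D p"
proof -
  obtain c d where q: "quotient_of (of_int a / of_int b) = (c, d)" by fastforce
  have "d > 0" using q by (rule quotient_of_denom_pos)
  have "b \<noteq> 0" using assms by auto
  have "coprime c d" using q by (rule quotient_of_coprime)
  have "of_int a / of_int b = (of_int c / of_int d :: rat)" using q by (rule quotient_of_div)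
  then have "of_int (a * d) = (of_int (c * b) :: rat)"
    using \<open>d > 0\<close> \<open>b \<noteq> 0\<close> by (simp add: field_simps)
  then have "a * d = c * b" by (simp only: of_int_eq_iff)
  then have "d dvd b" using \<open>coprime c d\<close>
    by (metis coprime_commute coprime_dvd_mult_right_iff dvd_triv_right)
  then have "\<not> int p dvd d" using assms dvd_trans by blast
  then show ?thesis by (simp add: D_def q)
qed

lemma D_cases:
  assumes "x \<in> D p"
  obtains a b where "x = of_int a / of_int b" "\<not> int p dvd b" "b \<noteq> 0" "quotient_of x = (a, b)"
proof -
  obtain a b where q: "quotient_of x = (a, b)" by fastforce
  then show ?thesis
    using that [of a b] assms quotient_of_div [OF q] quotient_of_denom_pos [OF q]
    by (simp add: D_def)
qed

locale prime_modulus =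
  fixes p :: nat
  assumes prime: "prime p"
begin

lemma D_of_int [simp]: "of_int a \<in> D p"
proof -
  have "p \<noteq> 1" using prime by auto
  then show ?thesis using of_int_divide_in_D [of p 1 a] by simp
qed

lemma D_of_nat [simp]: "of_nat n \<in> D p"
  using D_of_int [of "int n"] by simp

lemma D_numeral [simp]: "0 \<in> D p" "1 \<in> D p" "numeral k \<in> D p"
  using D_of_nat [of 0] D_of_nat [of 1] D_of_nat [of "numeral k"] by simp_all

lemma not_dvd_mult: "\<not> int p dvd a \<Longrightarrow> \<not> int p dvd b \<Longrightarrow> \<not> int p dvd a * b"
  using prime by (simp add: prime_dvd_mult_iff)

lemma D_add [simp]: "x \<in> D p \<Longrightarrow> y \<in> D p \<Longrightarrow> x + y \<in> D p"
proof (elim D_cases)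
  fix a b c d
  assume *: "x = of_int a / of_int b" "\<not> int p dvd b" "b \<noteq> 0" "y = of_int c / of_int d"
    "\<not> int p dvd d" "d \<noteq> 0"
  then have "x + y = of_int (a * d + c * b) / of_int (b * d)" by (simp add: field_simps)
  then show ?thesis using * by (simp only: of_int_divide_in_D not_dvd_mult not_False_eq_True)
qed

lemma D_mult [simp]: "x \<in> D p \<Longrightarrow> y \<in> D p \<Longrightarrow> x * y \<in> D p"
proof (elim D_cases)
  fix a b c d
  assume *: "x = of_int a / of_int b" "\<not> int p dvd b" "y = of_int c / of_int d" "\<not> int p dvd d"
  then have "x * y = of_int (a * c) / of_int (b * d)" by simp
  then show ?thesis using * by (simp only: of_int_divide_in_D not_dvd_mult not_False_eq_True)
qed

lemma D_uminus [simp]: "x \<in> D p \<Longrightarrow> - x \<in> D p"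
  using D_mult [OF D_of_int [of "-1"]] by simp

lemma D_diff [simp]: "x \<in> D p \<Longrightarrow> y \<in> D p \<Longrightarrow> x - y \<in> D p"
  using D_add [of x "- y"] by simp

lemma D_power [simp]: "x \<in> D p \<Longrightarrow> x ^ n \<in> D p"
  by (induction n) simp_all

lemma D_sum [simp]: "(\<And>i. i \<in> A \<Longrightarrow> f i \<in> D p) \<Longrightarrow> sum f A \<in> D p"
  by (induction A rule: infinite_finite_induct) simp_all

lemma D_prod [simp]: "(\<And>i. i \<in> A \<Longrightarrow> f i \<in> D p) \<Longrightarrow> prod f A \<in> D p"
  by (induction A rule: infinite_finite_induct) simp_all

lemma rat_cong_refl [simp]: "rat_cong p x x"
  by (auto simp: rat_cong_def intro!: bexI [of _ 0])

lemma rat_cong_sym: "rat_cong p x y \<Longrightarrow> rat_cong p y x"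
  unfolding rat_cong_def by (metis D_uminus minus_diff_eq mult_minus_right)

lemma rat_cong_add: "rat_cong p x x' \<Longrightarrow> rat_cong p y y' \<Longrightarrow> rat_cong p (x + y) (x' + y')"
  unfolding rat_cong_def by (metis D_add add_diff_add distrib_left)

lemma rat_cong_trans [trans]: "rat_cong p x y \<Longrightarrow> rat_cong p y w \<Longrightarrow> rat_cong p x w"
  using rat_cong_add [of x y y w] by (simp add: rat_cong_def)

lemma rat_cong_mult_left: "rat_cong p x y \<Longrightarrow> c \<in> D p \<Longrightarrow> rat_cong p (c * x) (c * y)"
  unfolding rat_cong_def by (metis D_mult mult.left_commute right_diff_distrib)

lemma rat_cong_mult:
  assumes "rat_cong p x x'" "rat_cong p y y'" "x' \<in> D p" "y \<in> D p"
  shows "rat_cong p (x * y) (x' * y')"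
proof -
  have "rat_cong p (x * y) (x' * y)"
    using rat_cong_mult_left [OF assms(1,4)] by (simp add: mult.commute)
  also have "rat_cong p \<dots> (x' * y')"
    using assms(2,3) by (rule rat_cong_mult_left)
  finally show ?thesis .
qed

lemma rat_cong_diff:
  assumes "rat_cong p x x'" "rat_cong p y y'"
  shows "rat_cong p (x - y) (x' - y')"
  using rat_cong_add [OF assms(1) rat_cong_mult_left [OF assms(2) D_of_int [of "-1"]]] by simp

lemma rat_cong_in_D: "rat_cong p x y \<Longrightarrow> y \<in> D p \<Longrightarrow> x \<in> D p"
  unfolding rat_cong_def by (metis D_add D_mult D_of_nat diff_add_cancel)

lemma rat_cong_power: "rat_cong p x y \<Longrightarrow> y \<in> D p \<Longrightarrow> rat_cong p (x ^ n) (y ^ n)"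
  by (induction n) (auto intro!: rat_cong_mult dest: rat_cong_in_D)

lemma rat_cong_sum:
  "(\<And>i. i \<in> A \<Longrightarrow> rat_cong p (f i) (g i)) \<Longrightarrow> rat_cong p (sum f A) (sum g A)"
  by (induction A rule: infinite_finite_induct) (auto intro!: rat_cong_add)

lemma rat_cong_prod:
  "(\<And>i. i \<in> A \<Longrightarrow> rat_cong p (f i) (g i)) \<Longrightarrow> (\<And>i. i \<in> A \<Longrightarrow> g i \<in> D p) \<Longrightarrow>
    rat_cong p (prod f A) (prod g A)"
  by (induction A rule: infinite_finite_induct)
    (auto intro!: rat_cong_mult D_prod dest: rat_cong_in_D)

lemma rat_cong_of_int_0_iff: "rat_cong p (of_int a) 0 \<longleftrightarrow> int p dvd a"
proof
  assume "rat_cong p (of_int a) 0"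
  then obtain w where w: "w \<in> D p" "of_int a = of_nat p * w"
    by (auto simp: rat_cong_def)
  then obtain c d where cd: "w = of_int c / of_int d" "\<not> int p dvd d" "d \<noteq> 0"
    by (elim D_cases)
  then have "of_int (a * d) = (of_int (int p * c) :: rat)" using w by (simp add: field_simps)
  then have "a * d = int p * c" by (simp only: of_int_eq_iff)
  then have "int p dvd a * d" by simp
  then show "int p dvd a" using not_dvd_mult cd by blast
next
  assume "int p dvd a"
  then show "rat_cong p (of_int a) 0"
    by (auto simp: rat_cong_def elim!: dvdE)
qed

lemma rat_cong_of_int: "[a = b] (mod int p) \<Longrightarrow> rat_cong p (of_int a) (of_int b)"
  using rat_cong_of_int_0_iff [of "a - b"] by (simp add: rat_cong_def cong_iff_dvd_diff)

text \<open>\<open>D p\<close> is a local ring: outside the ideal generated by p the numerator is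
  prime to p, so swapping it with the denominator stays in \<open>D p\<close>.\<close>

lemma inverse_in_D:
  assumes "x \<in> D p" "\<not> rat_cong p x 0"
  shows "inverse x \<in> D p"
proof -
  obtain a b where ab: "x = of_int a / of_int b" "\<not> int p dvd b" "b \<noteq> 0"
    using assms(1) by (rule D_cases)
  have "\<not> int p dvd a"
  proof
    assume "int p dvd a"
    then obtain c where "a = int p * c" by blast
    then have "x = of_nat p * (of_int c / of_int b)" using ab by simp
    then show False using assms(2) ab of_int_divide_in_D [of p b c] by (auto simp: rat_cong_def)
  qed
  then show ?thesis using ab of_int_divide_in_D [of p a b] by simp
qed

lemma rat_cong_cancel:
  assumes "rat_cong p (x * y) w" "x \<in> D p" "\<not> rat_cong p x 0"
  shows "rat_cong p y (w / x)"
proof -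
  have "x \<noteq> 0" using assms(3) by auto
  then show ?thesis
    using rat_cong_mult_left [OF assms(1) inverse_in_D [OF assms(2,3)]]
    by (simp add: field_simps)
qed

lemma rat_not_cong_0_mult:
  assumes "x \<in> D p" "\<not> rat_cong p x 0" "\<not> rat_cong p y 0"
  shows "\<not> rat_cong p (x * y) 0"
  using rat_cong_cancel [of x y 0] assms by auto

section \<open>Fermat's theorem and Euler's criterion for p-integral rationals\<close>

lemma rat_fermat:
  assumes "x \<in> D p" "\<not> rat_cong p x 0"
  shows "rat_cong p (x ^ (p - 1)) 1"
proof -
  have int_case: "rat_cong p (of_int a ^ (p - 1)) 1" if "\<not> int p dvd a" for a
  proof -
    have "[a ^ (p - 1) = 1] (mod int p)"
    proof -
      have "coprime a (int p)"
        using prime that by (metis coprime_commute prime_imp_coprime prime_nat_int_transfer)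
      moreover have "residues (int p)"
        using prime_gt_1_nat [OF prime] by (simp add: residues_def)
      ultimately show ?thesis
        using residues.euler_theorem [of "int p" a] prime by (simp add: totient_prime)
    qed
    then show ?thesis using rat_cong_of_int by fastforce
  qed
  obtain a b where ab: "x = of_int a / of_int b" "\<not> int p dvd b" "b \<noteq> 0"
    using assms(1) by (rule D_cases)
  \<comment> \<open>Integer Fermat is applied to both a = bx and b; the power of b then drops out of
    the power of bx.\<close>
  have bx: "of_int a = of_int b * x" using ab by simp
  have nb: "\<not> rat_cong p (of_int b) 0" using ab rat_cong_of_int_0_iff by simp
  then have "\<not> rat_cong p (of_int a) 0"
    unfolding bx using assms by (intro rat_not_cong_0_mult) auto
  then have "\<not> int p dvd a" by (simp only: rat_cong_of_int_0_iff not_False_eq_True)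
  then have "rat_cong p (of_int b ^ (p - 1) * x ^ (p - 1)) 1"
    using int_case [of a] unfolding bx power_mult_distrib by simp
  moreover have "rat_cong p (x ^ (p - 1) * of_int b ^ (p - 1)) (x ^ (p - 1) * 1)"
    using int_case [OF ab(2)] assms(1) by (intro rat_cong_mult_left) auto
  ultimately show ?thesis
    by (metis mult.commute mult.right_neutral rat_cong_sym rat_cong_trans)
qed

lemma rat_fermat':
  assumes "x \<in> D p"
  shows "rat_cong p (x ^ p) x"
proof -
  have eq: "x ^ p = x * x ^ (p - 1)"
    using prime by (metis power_eq_if prime_gt_0_nat less_numeral_extra(3))
  show ?thesis
  proof (cases "rat_cong p x 0")
    case True
    have "rat_cong p (x * x ^ (p - 1)) (0 * x ^ (p - 1))"
      using assms True by (intro rat_cong_mult) auto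
    then show ?thesis unfolding eq using True rat_cong_sym rat_cong_trans by (metis mult_zero_left)
  next
    case False
    then show ?thesis
      unfolding eq using rat_cong_mult_left [OF rat_fermat [OF assms False] assms] by simp
  qed
qed

text \<open>The symbol is taken at ab = x b^2, so the integer criterion yields x^((p - 1)/2) times
  b^(p - 1), and the last factor is 1 by Fermat.\<close>

lemma rat_euler_criterion:
  assumes "2 < p" "x \<in> D p"
  shows "rat_cong p (x ^ ((p - 1) div 2)) (of_int (rat_Legendre x p))"
proof -
  let ?n = "(p - 1) div 2"
  have "odd p" using prime assms(1) by (simp add: prime_odd_nat)
  then have n: "2 * ?n = p - 1" by simp
  obtain a b where ab: "x = of_int a / of_int b" "\<not> int p dvd b" "b \<noteq> 0" "quotient_of x = (a, b)"
    using assms(2) by (rule D_cases)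
  have nb: "\<not> rat_cong p (of_int b) 0" using ab rat_cong_of_int_0_iff by simp
  have "rat_cong p (of_int (rat_Legendre x p)) (of_int ((a * b) ^ ?n))"
    unfolding rat_Legendre_def ab(4) fst_conv snd_conv
    using euler_criterion [OF prime assms(1)] by (intro rat_cong_of_int) auto
  also have "of_int ((a * b) ^ ?n) = (x * of_int b ^ 2) ^ ?n"
    using ab by (simp add: power2_eq_square)
  also have "\<dots> = x ^ ?n * of_int b ^ (p - 1)"
    by (simp only: power_mult_distrib n flip: power_mult)
  also have "rat_cong p \<dots> (x ^ ?n * 1)"
    using rat_fermat [OF D_of_int nb] assms by (intro rat_cong_mult_left) auto
  finally show ?thesis using rat_cong_sym by simp
qed

section \<open>Binomial coefficients modulo p and the Frobenius map\<close>

lemma rat_not_cong_0_fact: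
  assumes "k < p"
  shows "\<not> rat_cong p (fact k) 0"
  using rat_cong_of_int_0_iff [of "fact k"] prime assms
  by (metis int_dvd_int_iff not_le of_int_fact of_nat_fact prime_dvd_fact_iff)

text \<open>The falling factorial is a polynomial in its argument, and k! is invertible modulo p for
  k < p.\<close>

lemma rat_cong_gbinomial:
  fixes x y :: rat
  assumes "k < p" "rat_cong p x y" "y \<in> D p"
  shows "rat_cong p (x gchoose k) (y gchoose k)"
proof -
  have "rat_cong p (\<Prod>i = 0..<k. x - of_nat i) (\<Prod>i = 0..<k. y - of_nat i)"
    using assms by (intro rat_cong_prod rat_cong_diff) auto
  then have "rat_cong p (fact k * (x gchoose k)) (fact k * (y gchoose k))"
    by (simp add: gbinomial_mult_fact)
  then have "rat_cong p (x gchoose k) (fact k * (y gchoose k) / fact k)"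
    using rat_not_cong_0_fact [OF assms(1)] D_of_nat [of "fact k"]
    by (intro rat_cong_cancel) auto
  then show ?thesis by simp
qed

text \<open>Negating the upper argument turns M into k - M - 1, which is congruent to N by the
  second assumption. Generalized binomials are used because k - M - 1 may be negative.\<close>

lemma rat_cong_binomial_reflect:
  assumes "k < p" "M + N + 1 = c * p + k"
  shows "rat_cong p (of_nat (M choose k)) ((-1) ^ k * of_nat (N choose k))"
proof -
  have "of_nat M + of_nat N + 1 = (of_nat c * of_nat p + of_nat k :: rat)"
    using arg_cong [OF assms(2), of "of_nat :: nat \<Rightarrow> rat"] by simp
  then have "(of_nat k - of_nat M - 1 :: rat) - of_nat N = of_nat p * - of_nat c"
    by (simp add: algebra_simps)
  then have "rat_cong p (of_nat k - of_nat M - 1) (of_nat N)"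
    unfolding rat_cong_def by (intro bexI [of _ "- of_nat c"]) auto
  then have "rat_cong p ((of_nat k - of_nat M - 1) gchoose k) (of_nat N gchoose k)"
    using assms by (intro rat_cong_gbinomial) auto
  then have "rat_cong p ((-1) ^ k * ((of_nat k - of_nat M - 1) gchoose k)) ((-1) ^ k * (of_nat N gchoose k))"
    using D_of_int [of "(-1) ^ k"] by (intro rat_cong_mult_left) auto
  then show ?thesis
    by (simp add: binomial_gbinomial gbinomial_negated_upper [of "of_nat M"])
qed

text \<open>Since p divides the inner binomials, only the terms with i = 0 and i = p survive, and
  P^p reduces to P by Fermat.\<close>

lemma rat_cong_binomial_transform:
  assumes "P \<in> D p" "\<And>i. w i \<in> D p"
  shows "rat_cong p (binomial_transform P w p) (P * w 0 + w p)"
proof -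
  obtain q where q: "p = Suc q" using prime by (cases p) auto
  have z: "rat_cong p (\<Sum>i<q. of_nat (p choose Suc i) * P ^ (q - i) * w (Suc i)) (\<Sum>i<q. 0)"
  proof (rule rat_cong_sum)
    fix i assume "i \<in> {..<q}"
    then have "p dvd p choose Suc i"
      using prime q by (intro dvd_choose_prime) auto
    then have "rat_cong p (of_int (int (p choose Suc i))) 0"
      unfolding rat_cong_of_int_0_iff by simp
    then have "rat_cong p (of_nat (p choose Suc i) * (P ^ (q - i) * w (Suc i))) (0 * (P ^ (q - i) * w (Suc i)))"
      using assms by (intro rat_cong_mult) auto
    then show "rat_cong p (of_nat (p choose Suc i) * P ^ (q - i) * w (Suc i)) 0"
      by (simp add: mult.assoc)
  qed
  have "binomial_transform P w p = P ^ p * w 0 + (\<Sum>i\<le>q. of_nat (p choose Suc i) * P ^ (q - i) * w (Suc i))"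
    unfolding binomial_transform_def q by (subst sum.atMost_Suc_shift) simp
  also have "\<dots> = P ^ p * w 0 + (\<Sum>i<q. of_nat (p choose Suc i) * P ^ (q - i) * w (Suc i)) + w p"
    by (simp add: q flip: lessThan_Suc_atMost)
  also have "rat_cong p \<dots> (P * w 0 + 0 + w p)"
    using z assms rat_fermat' [of P] by (intro rat_cong_add rat_cong_mult) auto
  finally show ?thesis by simp
qed

lemma rat_cong_quad_re:
  assumes "odd p" "P \<in> D p" "E \<in> D p"
  shows "rat_cong p (quad_re P E p) P"
  using rat_cong_binomial_transform [OF assms(2), of "\<lambda>i. if even i then E ^ (i div 2) else 0"] assms
  by (simp add: quad_re_def)

lemma rat_cong_quad_im:
  assumes "odd p" "P \<in> D p" "E \<in> D p"
  shows "rat_cong p (quad_im P E p) (E ^ ((p - 1) div 2))"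
proof -
  have "p div 2 = (p - 1) div 2" using assms(1) by (auto elim!: oddE)
  then show ?thesis
    using rat_cong_binomial_transform [OF assms(2), of "\<lambda>i. if odd i then E ^ (i div 2) else 0"] assms
    by (simp add: quad_im_def)
qed

section \<open>The binomial sums as values of the cubic sequence\<close>

lemma rat_cong_sum_binomial:
  assumes "z \<in> D p" "K < p" "2 * K + 1 \<le> c * p" "c * p \<le> 3 * K + 3"
  shows "rat_cong p (\<Sum>k\<le>K. of_nat ((3 * k) choose k) * z ^ k) (cubic_seq z (c * p - 1))"
proof -
  \<comment> \<open>The bound \<open>c * p \<le> 3 * K + 3\<close> makes the cutoff \<open>K\<close>
    lose no term; \<open>2 * K + 1 \<le> c * p\<close> keeps the subtractions below from
    truncating.\<close>
  have "cubic_seq z (c * p - 1) = (\<Sum>k\<le>K. of_nat ((c * p - 1 - 2 * k) choose k) * (- z) ^ k)"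
    using assms by (intro cubic_seq_eq) auto
  moreover have "rat_cong p (\<Sum>k\<le>K. of_nat ((3 * k) choose k) * z ^ k)
     (\<Sum>k\<le>K. of_nat ((c * p - 1 - 2 * k) choose k) * (- z) ^ k)"
  proof (rule rat_cong_sum)
    fix k assume k: "k \<in> {..K}"
    then have "rat_cong p (of_nat ((3 * k) choose k)) ((-1) ^ k * of_nat ((c * p - 1 - 2 * k) choose k))"
      using assms by (intro rat_cong_binomial_reflect [where c = c]) auto
    then have "rat_cong p (z ^ k * of_nat ((3 * k) choose k))
       (z ^ k * ((-1) ^ k * of_nat ((c * p - 1 - 2 * k) choose k)))"
      using assms(1) by (intro rat_cong_mult_left) auto
    then show "rat_cong p (of_nat ((3 * k) choose k) * z ^ k)
       (of_nat ((c * p - 1 - 2 * k) choose k) * (- z) ^ k)"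
      by (simp add: power_minus [of z] mult_ac)
  qed
  ultimately show ?thesis by simp
qed

lemma rat_cong_sum_binomial_shifted:
  assumes "z \<in> D p" "K < p" "2 * K + 2 \<le> c * p" "c * p \<le> 3 * K + 3" "0 < K"
  shows "rat_cong p (\<Sum>k = 1..K. of_nat ((3 * k) choose (k - 1)) * z ^ k)
     (z * cubic_seq z (c * p - 4))"
proof -
  obtain J where J: "K = Suc J" using assms(5) by (cases K) auto
  have "cubic_seq z (c * p - 4) = (\<Sum>k\<le>J. of_nat ((c * p - 4 - 2 * k) choose k) * (- z) ^ k)"
    using assms J by (intro cubic_seq_eq) auto
  then have "z * cubic_seq z (c * p - 4)
      = (\<Sum>k\<le>J. z ^ Suc k * ((-1) ^ k * of_nat ((c * p - 4 - 2 * k) choose k)))"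
    by (simp add: sum_distrib_left power_minus [of z] mult_ac)
  moreover have "rat_cong p (\<Sum>k\<le>J. z ^ Suc k * of_nat ((3 * Suc k) choose k))
     (\<Sum>k\<le>J. z ^ Suc k * ((-1) ^ k * of_nat ((c * p - 4 - 2 * k) choose k)))"
  proof (rule rat_cong_sum)
    fix k assume k: "k \<in> {..J}"
    \<comment> \<open>Reflection with M = 3k + 3 and N = cp - 4 - 2k, so that M + N + 1 = cp + k;
      the index shift by one accounts for the 4.\<close>
    then have "rat_cong p (of_nat ((3 * Suc k) choose k)) ((-1) ^ k * of_nat ((c * p - 4 - 2 * k) choose k))"
      using assms J by (intro rat_cong_binomial_reflect [where c = c]) auto
    then show "rat_cong p (z ^ Suc k * of_nat ((3 * Suc k) choose k))
       (z ^ Suc k * ((-1) ^ k * of_nat ((c * p - 4 - 2 * k) choose k)))"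
      using assms(1) by (intro rat_cong_mult_left D_power)
  qed
  moreover have "(\<Sum>k = 1..K. of_nat ((3 * k) choose (k - 1)) * z ^ k)
      = (\<Sum>k\<le>J. z ^ Suc k * of_nat ((3 * Suc k) choose k))"
    unfolding J One_nat_def sum.shift_bounds_cl_Suc_ivl atLeast0AtMost
    by (simp add: mult_ac)
  ultimately show ?thesis by simp
qed

lemma rat_cong_sum_catalan2:
  assumes "z \<in> D p" "K < p" "2 * K + 2 \<le> c * p" "c * p \<le> 3 * K + 3" "0 < K"
  shows "rat_cong p (\<Sum>k = 1..K. catalan2 k * z ^ k)
     (3 * cubic_seq z (c * p - 1) - 2 * cubic_seq z (c * p - 2) - 1)"
proof -
  have "c * p \<ge> 4" using assms by linarith
  then have "Suc (Suc (Suc (c * p - 4))) = c * p - 1" "Suc (Suc (c * p - 4)) = c * p - 2"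
    by auto
  \<comment> \<open>Running the recurrence backwards removes the factor \<open>z\<close>;
    subtracting twice this difference from u_(cp-1) leaves 3 u_(cp-1) - 2 u_(cp-2). The final -1 in
    the claim is the missing term k = 0.\<close>
  then have zu: "z * cubic_seq z (c * p - 4) = cubic_seq z (c * p - 2) - cubic_seq z (c * p - 1)"
    using cubic_seq_rec [of z "c * p - 4"] by simp
  have "(\<Sum>k = 1..K. catalan2 k * z ^ k) = (\<Sum>k = 1..K. of_nat ((3 * k) choose k) * z ^ k)
      - 2 * (\<Sum>k = 1..K. of_nat ((3 * k) choose (k - 1)) * z ^ k)"
    unfolding sum_distrib_left sum_subtractf [symmetric]
    by (rule sum.cong) (auto simp: catalan2_eq algebra_simps)
  also have "(\<Sum>k = 1..K. of_nat ((3 * k) choose k) * z ^ k)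
      = (\<Sum>k\<le>K. of_nat ((3 * k) choose k) * z ^ k) - 1"
    by (simp add: atMost_atLeast0 sum.atLeast_Suc_atMost)
  also have "rat_cong p (\<dots> - 2 * (\<Sum>k = 1..K. of_nat ((3 * k) choose (k - 1)) * z ^ k))
     ((cubic_seq z (c * p - 1) - 1) - 2 * (z * cubic_seq z (c * p - 4)))"
    using assms by (intro rat_cong_diff rat_cong_mult_left rat_cong_sum_binomial
        rat_cong_sum_binomial_shifted) auto
  finally show ?thesis unfolding zu by (simp add: algebra_simps)
qed

section \<open>Evaluation modulo p of the truncated and the full sums\<close>

context
  fixes t P E z L :: rat
  assumes p_gt_3: "p > 3" and t: "t \<in> D p"
  defines "P \<equiv> (t + 1) / 2" and "E \<equiv> (1 + t) * (1 - 3 * t) / 4" and "z \<equiv> t\<^sup>2 * (t + 1)"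
    and "L \<equiv> of_int (rat_Legendre ((1 + t) * (1 - 3 * t)) p)"
begin

lemma odd_p: "odd p"
  using prime p_gt_3 by (simp add: prime_odd_nat)

lemma not_cong_2: "\<not> rat_cong p 2 0"
  using rat_cong_of_int_0_iff [of 2] p_gt_3 zdvd_imp_le [of "int p" 2] by auto

lemma D_half [simp]: "x \<in> D p \<Longrightarrow> x / 2 \<in> D p"
  unfolding divide_inverse by (rule D_mult [OF _ inverse_in_D [OF D_numeral(3) not_cong_2]])

lemma PEz_in_D [simp]: "P \<in> D p" "E \<in> D p" "z \<in> D p" "L \<in> D p"
proof -
  have "E = (1 + t) * (1 - 3 * t) / 2 / 2" by (simp add: E_def)
  then show "E \<in> D p"
    using t by (simp only: D_half D_mult D_add D_diff D_numeral)
qed (use t in \<open>simp_all add: P_def z_def L_def\<close>)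

lemma quad_re_p: "rat_cong p (quad_re P E p) P"
  using odd_p by (intro rat_cong_quad_re) auto

lemma quad_im_p: "rat_cong p (quad_im P E p) L"
proof -
  let ?n = "(p - 1) div 2"
  have n: "2 * ?n = p - 1" using odd_p by simp
  have "rat_cong p (quad_im P E p) (E ^ ?n)"
    using odd_p by (intro rat_cong_quad_im) auto
  \<comment> \<open>The factor 2^(p - 1), congruent to 1, clears the denominator 4 of
    \<open>E\<close>, so that Euler's criterion applies to the argument of the symbol in
    \<open>L\<close>.\<close>
  also have "rat_cong p (E ^ ?n) (E ^ ?n * 2 ^ (p - 1))"
    using rat_cong_mult_left [OF rat_fermat [OF D_numeral(3) not_cong_2], of "E ^ ?n"]
    by (simp add: rat_cong_sym)
  also have "E ^ ?n * 2 ^ (p - 1) = (E * 2\<^sup>2) ^ ?n"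
    by (simp only: power_mult_distrib n flip: power_mult)
  also have "E * 2\<^sup>2 = (1 + t) * (1 - 3 * t)" by (simp add: E_def)
  also have "rat_cong p (((1 + t) * (1 - 3 * t)) ^ ?n) L"
    unfolding L_def using p_gt_3 t by (intro rat_euler_criterion) auto
  finally show ?thesis .
qed

lemma quad_re_2p: "rat_cong p (quad_re P E (2 * p)) (P\<^sup>2 + E)"
proof -
  let ?n = "(p - 1) div 2"
  have n: "Suc (2 * ?n) = p" using odd_p by simp
  have "quad_re P E (2 * p) = quad_re P E p ^ 2 + E * quad_im P E p ^ 2"
    using quad_add(1) [of P E p p] by (simp add: power2_eq_square mult.assoc flip: mult_2)
  \<comment> \<open>Keeping the power of \<open>E\<close> instead of \<open>L\<close> produces
    \<open>E ^ p\<close>, which Fermat reduces to \<open>E\<close> even when \<open>E\<close> is 0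
    modulo p.\<close>
  also have "rat_cong p \<dots> (P\<^sup>2 + E * (E ^ ?n)\<^sup>2)"
    using odd_p
    by (intro rat_cong_add rat_cong_mult_left rat_cong_power quad_re_p rat_cong_quad_im) auto
  also have "E * (E ^ ?n)\<^sup>2 = E ^ Suc (2 * ?n)"
    by (simp add: mult.commute flip: power_mult)
  also have "\<dots> = E ^ p" by (simp only: n)
  also have "rat_cong p (P\<^sup>2 + E ^ p) (P\<^sup>2 + E)"
    by (intro rat_cong_add rat_cong_refl rat_fermat') auto
  finally show ?thesis .
qed

lemma quad_im_2p: "rat_cong p (quad_im P E (2 * p)) ((t + 1) * L)"
proof -
  have "quad_im P E (2 * p) = 2 * (quad_re P E p * quad_im P E p)"
    using quad_add(2) [of P E p p] by (simp add: algebra_simps flip: mult_2)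
  also have "rat_cong p \<dots> (2 * (P * L))"
    using rat_cong_in_D [OF quad_im_p]
    by (intro rat_cong_mult_left rat_cong_mult quad_re_p quad_im_p) auto
  finally show ?thesis by (simp add: P_def)
qed

text \<open>Treats c = 1 and c = 2 together: \<open>T\<close> is the contribution of the root -t,
  while \<open>A\<close> and \<open>B\<close> are the components of the cp-th power of P + s. The
  subtracted 2t and 2(3t + 2) come from the term k = 0.\<close>

lemma rat_cong_sums:
  assumes K: "0 < K" "K < p" "2 * K + 2 \<le> c * p" "c * p \<le> 3 * K + 3"
    and T: "rat_cong p (t * (- t) ^ (c * p - 1)) T"
    and A: "rat_cong p (quad_re P E (c * p)) A"
    and B: "rat_cong p (quad_im P E (c * p)) B"
  shows "\<not> rat_cong p t 0 \<Longrightarrow> rat_cong p (\<Sum>k = 1..K. catalan2 k * z ^ k)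
      ((2 * T + (3 * t - 1) * B + 2 * A - 2 * t) / (2 * t))"
    and "\<not> rat_cong p (3 * t + 2) 0 \<Longrightarrow> rat_cong p (\<Sum>k = 1..K. of_nat ((3 * k) choose k) * z ^ k)
      ((2 * T + 3 * (t + 1) * B + 2 * A - 2 * (3 * t + 2)) / (2 * (3 * t + 2)))"
proof -
  obtain n where n: "c * p = Suc (Suc n)"
    using K by (cases "c * p"; cases "c * p - 1") auto
  assume nt: "\<not> rat_cong p t 0"
  have "rat_cong p (2 * t * (\<Sum>k = 1..K. catalan2 k * z ^ k))
      (2 * t * (3 * cubic_seq z (Suc n) - 2 * cubic_seq z n - 1))"
    using rat_cong_sum_catalan2 [OF PEz_in_D(3), of K c] K t
    by (intro rat_cong_mult_left) (auto simp: n)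
  also have "\<dots> = 2 * t * (3 * cubic_seq z (Suc n) - 2 * cubic_seq z n) - 2 * t"
    by (simp add: algebra_simps)
  also have "\<dots> = 2 * (t * (- t) ^ (c * p - 1)) + (3 * t - 1) * quad_im P E (c * p)
      + 2 * quad_re P E (c * p) - 2 * t"
    unfolding z_def cubic_seq_catalan_form n P_def E_def by simp
  also have "rat_cong p \<dots> (2 * T + (3 * t - 1) * B + 2 * A - 2 * t)"
    using t by (intro rat_cong_diff rat_cong_add rat_cong_mult_left T A B) auto
  finally show "rat_cong p (\<Sum>k = 1..K. catalan2 k * z ^ k)
      ((2 * T + (3 * t - 1) * B + 2 * A - 2 * t) / (2 * t))"
    using t nt not_cong_2 by (intro rat_cong_cancel rat_not_cong_0_mult) auto
next
  assume nt: "\<not> rat_cong p (3 * t + 2) 0"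
  obtain n where n: "c * p = Suc n"
    using K by (cases "c * p") auto
  have "rat_cong p (2 * (3 * t + 2) * (\<Sum>k\<le>K. of_nat ((3 * k) choose k) * z ^ k))
      (2 * (3 * t + 2) * cubic_seq z n)"
    using rat_cong_sum_binomial [OF PEz_in_D(3), of K c] K t
    by (intro rat_cong_mult_left) (auto simp: n)
  also have "\<dots> = 2 * (t * (- t) ^ (c * p - 1)) + 3 * (t + 1) * quad_im P E (c * p)
      + 2 * quad_re P E (c * p)"
    unfolding z_def cubic_seq_closed_form n P_def E_def by simp
  also have "rat_cong p \<dots> (2 * T + 3 * (t + 1) * B + 2 * A)"
    using t by (intro rat_cong_add rat_cong_mult_left T A B) auto
  finally have "rat_cong p (2 * (3 * t + 2) * (\<Sum>k\<le>K. of_nat ((3 * k) choose k) * z ^ k)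
      - 2 * (3 * t + 2)) (2 * T + 3 * (t + 1) * B + 2 * A - 2 * (3 * t + 2))"
    by (rule rat_cong_diff) simp
  also have "2 * (3 * t + 2) * (\<Sum>k\<le>K. of_nat ((3 * k) choose k) * z ^ k) - 2 * (3 * t + 2)
      = 2 * (3 * t + 2) * (\<Sum>k = 1..K. of_nat ((3 * k) choose k) * z ^ k)"
    by (simp add: atMost_atLeast0 sum.atLeast_Suc_atMost distrib_left)
  finally show "rat_cong p (\<Sum>k = 1..K. of_nat ((3 * k) choose k) * z ^ k)
      ((2 * T + 3 * (t + 1) * B + 2 * A - 2 * (3 * t + 2)) / (2 * (3 * t + 2)))"
    using t nt not_cong_2 by (intro rat_cong_cancel rat_not_cong_0_mult) auto
qed

lemma truncated_sums:
  shows "\<not> rat_cong p t 0 \<Longrightarrow> rat_cong p (\<Sum>k = 1..p div 3. catalan2 k * z ^ k)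
      ((1 + t) / (2 * t) - (1 - 3 * t) / (2 * t) * L)"
    and "\<not> rat_cong p (3 * t + 2) 0 \<Longrightarrow>
      rat_cong p (\<Sum>k = 1..p div 3. of_nat ((3 * k) choose k) * z ^ k)
        (3 * (t + 1) / (2 * (3 * t + 2)) * (L - 1))"
proof -
  have K: "0 < p div 3" "p div 3 < p" "2 * (p div 3) + 2 \<le> 1 * p" "1 * p \<le> 3 * (p div 3) + 3"
    using p_gt_3 by linarith+
  \<comment> \<open>Here p - 1 is even, so the sign disappears.\<close>
  have "t * (- t) ^ (1 * p - 1) = t ^ p"
    using odd_p by (auto elim!: oddE)
  then have T: "rat_cong p (t * (- t) ^ (1 * p - 1)) t"
    using rat_fermat' [OF t] by simp
  note sums = rat_cong_sums [OF K T, of P L, unfolded mult_1, OF quad_re_p quad_im_p]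
  show "rat_cong p (\<Sum>k = 1..p div 3. catalan2 k * z ^ k)
      ((1 + t) / (2 * t) - (1 - 3 * t) / (2 * t) * L)" if nt: "\<not> rat_cong p t 0"
  proof -
    have "2 * t + (3 * t - 1) * L + 2 * P - 2 * t = (1 + t) - (1 - 3 * t) * L"
      by (simp add: P_def algebra_simps)
    then show ?thesis using sums(1) [OF nt] by (simp only: times_divide_eq_left flip: diff_divide_distrib)
  qed
  show "rat_cong p (\<Sum>k = 1..p div 3. of_nat ((3 * k) choose k) * z ^ k)
      (3 * (t + 1) / (2 * (3 * t + 2)) * (L - 1))" if nt: "\<not> rat_cong p (3 * t + 2) 0"
  proof -
    have "2 * t + 3 * (t + 1) * L + 2 * P - 2 * (3 * t + 2) = 3 * (t + 1) * (L - 1)"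
      by (simp add: P_def algebra_simps)
    then show ?thesis using sums(2) [OF nt] by (simp only: times_divide_eq_left)
  qed
qed

lemma full_sums:
  shows "\<not> rat_cong p t 0 \<Longrightarrow> rat_cong p (\<Sum>k = 1..p - 1. catalan2 k * z ^ k)
      ((1 + t) * (1 - 3 * t) / (2 * t) * (1 - L))"
    and "\<not> rat_cong p (3 * t + 2) 0 \<Longrightarrow>
      rat_cong p (\<Sum>k = 1..p - 1. of_nat ((3 * k) choose k) * z ^ k)
        (3 * (t + 1)^2 / (2 * (3 * t + 2)) * (L - 1))"
proof -
  have K: "0 < p - 1" "p - 1 < p" "2 * (p - 1) + 2 \<le> 2 * p" "2 * p \<le> 3 * (p - 1) + 3"
    using p_gt_3 by linarith+
  \<comment> \<open>The exponent 2p - 1 is odd, in contrast to p - 1 in the truncated case, so the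
    root -t now contributes -t^(2p), congruent to -t^2.\<close>
  have "t * (- t) ^ (2 * p - 1) = - ((- t) ^ Suc (2 * p - 1))" by simp
  also have "Suc (2 * p - 1) = 2 * p" using p_gt_3 by simp
  also have "- ((- t) ^ (2 * p)) = - 1 * (t ^ p) ^ 2"
    by (simp add: mult.commute flip: power_mult)
  finally have eq: "t * (- t) ^ (2 * p - 1) = - 1 * (t ^ p) ^ 2" .
  have T: "rat_cong p (t * (- t) ^ (2 * p - 1)) (- 1 * t\<^sup>2)"
    unfolding eq using rat_fermat' [OF t] t by (intro rat_cong_mult_left rat_cong_power) auto
  have PE: "2 * (P\<^sup>2 + E) = (1 + t) * (1 - t)"
  proof -
    have "4 * P\<^sup>2 = (t + 1)\<^sup>2" "4 * E = (1 + t) * (1 - 3 * t)"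
      by (simp_all add: P_def E_def power_divide)
    then show ?thesis by (simp add: algebra_simps power2_eq_square)
  qed
  note sums = rat_cong_sums [OF K T quad_re_2p quad_im_2p]
  show "rat_cong p (\<Sum>k = 1..p - 1. catalan2 k * z ^ k)
      ((1 + t) * (1 - 3 * t) / (2 * t) * (1 - L))" if nt: "\<not> rat_cong p t 0"
  proof -
    have "2 * (- 1 * t\<^sup>2) + (3 * t - 1) * ((t + 1) * L) + 2 * (P\<^sup>2 + E) - 2 * t
        = (1 + t) * (1 - 3 * t) * (1 - L)"
      unfolding PE by (simp add: algebra_simps power2_eq_square)
    then show ?thesis using sums(1) [OF nt] by (simp only: times_divide_eq_left)
  qed
  show "rat_cong p (\<Sum>k = 1..p - 1. of_nat ((3 * k) choose k) * z ^ k)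
      (3 * (t + 1)^2 / (2 * (3 * t + 2)) * (L - 1))" if nt: "\<not> rat_cong p (3 * t + 2) 0"
  proof -
    have "2 * (- 1 * t\<^sup>2) + 3 * (t + 1) * ((t + 1) * L) + 2 * (P\<^sup>2 + E) - 2 * (3 * t + 2)
        = 3 * (t + 1)^2 * (L - 1)"
      unfolding PE by (simp add: algebra_simps power2_eq_square)
    then show ?thesis using sums(2) [OF nt] by (simp only: times_divide_eq_left)
  qed
qed

end

end

theorem theorem21:
  fixes p :: nat and t :: rat
  assumes "prime p" and "p > 3" and "t \<in> D p"
  shows "(\<not> rat_cong p t 0 \<longrightarrow>
            rat_cong p (\<Sum>k = 1..p div 3. catalan2 k * (t^2 * (t + 1)) ^ k)
              ((1 + t) / (2 * t)
                - (1 - 3 * t) / (2 * t) * of_int (rat_Legendre ((1 + t) * (1 - 3 * t)) p)) \<and>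
            rat_cong p (\<Sum>k = 1..p - 1. catalan2 k * (t^2 * (t + 1)) ^ k)
              ((1 + t) * (1 - 3 * t) / (2 * t)
                * (1 - of_int (rat_Legendre ((1 + t) * (1 - 3 * t)) p)))) \<and>
         (\<not> rat_cong p (3 * t + 2) 0 \<longrightarrow>
            rat_cong p (\<Sum>k = 1..p div 3. of_nat ((3 * k) choose k) * (t^2 * (t + 1)) ^ k)
              (3 * (t + 1) / (2 * (3 * t + 2))
                * (of_int (rat_Legendre ((1 + t) * (1 - 3 * t)) p) - 1)) \<and>
            rat_cong p (\<Sum>k = 1..p - 1. of_nat ((3 * k) choose k) * (t^2 * (t + 1)) ^ k)
              (3 * (t + 1)^2 / (2 * (3 * t + 2))
                * (of_int (rat_Legendre ((1 + t) * (1 - 3 * t)) p) - 1)))"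
proof -
  interpret prime_modulus p using assms(1) by unfold_locales
  show ?thesis
    by (intro conjI impI truncated_sums full_sums assms)
qed

end
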